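(* Let $M$ be a positive integer, let $N_i\in\mathbb{N}$ be such that $N_i+1$ divides $M$, and let $S\in\mathbb{N}\cup\{0\}$ with $S\le N_i$. Let $(X_n)_{n=0}^{M-1}$ be a sequence of complex numbers, and let $(Y_n)_{n=0}^{M-1}$ be the sequence obtained from $(X_n)$ by zeroing the elements whose index $n$ satisfies $\frac{n-S}{N_i+1}\in\mathbb{Z}$, i.e. $Y_n=0$ if $\frac{n-S}{N_i+1}\in\mathbb{Z}$ and $Y_n=X_n$ otherwise. Let $(x_k)_{k=0}^{M-1}$ and $(y_k)_{k=0}^{M-1}$ be the inverse discrete Fourier transforms (IDFTs) of $(X_n)$ and $(Y_n)$, respectively. Then the IDFT of $(Y_n)$ decomposes as $$y_k = x_k + r_k,\qquad k=0,\dots,M-1,$$ where $(r_k)_{k=0}^{M-1}$ is a sequence of the form $$r_k = p_k\, e^{j2\pi k\frac{S}{M}},\qquad k=0,\dots,M-1,$$ and $(p_k)$ is a periodic sequence with period $\frac{M}{N_i+1}$, i.e. $p_k=p_{k+\frac{M}{N_i+1}}$ whenever both indices lie in $\{0,\dots,M-1\}$.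
   Context: Here $j$ denotes the imaginary unit and $\mathbb{N}=\{1,2,3,\dots\}$. The IDFT of a complex sequence $(Z_n)_{n=0}^{M-1}$ of size $M$ is the sequence $(z_k)_{k=0}^{M-1}$ given by $z_k=\sum_{n=0}^{M-1} Z_n e^{j2\pi k\frac{n}{M}}$ (unnormalized convention). "Period $T$" means that shifting the index by $T$ leaves the value unchanged; $T$ is not required to be the minimal period. *)

theory Defs
  imports Complex_Main
begin

text \<open>
  A sequence of size \<open>M\<close> is represented by a function on \<open>nat\<close> of which only the values at
  indices below \<open>M\<close> matter.
\<close>

definition idft :: "nat \<Rightarrow> (nat \<Rightarrow> complex) \<Rightarrow> nat \<Rightarrow> complex" where
  "idft M Z k = (\<Sum>n<M. Z n * exp (\<i> * of_real (2 * pi * real k * (real n / real M))))"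

text \<open>The differences are taken in \<open>real\<close>, since \<open>n - S\<close> truncates on \<open>nat\<close>.\<close>

definition zero_out :: "nat \<Rightarrow> nat \<Rightarrow> (nat \<Rightarrow> complex) \<Rightarrow> nat \<Rightarrow> complex" where
  "zero_out N S X n = (if (real n - real S) / (real N + 1) \<in> \<int> then 0 else X n)"

end

theory Submission
  imports Defs
begin

text \<open>
  The removed frequencies are \<open>n = S + c (N + 1)\<close> with \<open>c\<close> an integer. Factoring the character
  of frequency \<open>S\<close> out of their contribution leaves characters of frequency \<open>c (N + 1)\<close>,
  all of which have period \<open>M / (N + 1)\<close>.
\<close>

text \<open>Moving the index by \<open>L\<close> adds \<open>L * d / M = d / (N + 1)\<close> full
  turns to the phase, an integer number. Taking \<open>d\<close> real admits the negative
  differences \<open>n - S\<close>.\<close>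

lemma exp_char_periodic:
  fixes k L N M :: nat and d :: real
  assumes "M = (N + 1) * L" and "M > 0" and "d / (real N + 1) \<in> \<int>"
  shows "exp (\<i> * of_real (2 * pi * real (k + L) * (d / real M)))
    = exp (\<i> * of_real (2 * pi * real k * (d / real M)))"
proof -
  obtain c :: int where c: "d / (real N + 1) = of_int c"
    using assms(3) by (elim Ints_cases)
  \<comment> \<open>Needed to cancel \<open>L\<close> in
    \<open>L * d / ((N + 1) * L)\<close>.\<close>
  have "L > 0"
    using assms(1,2) by (cases L) auto
  moreover have "real M = (real N + 1) * real L"
    using assms(1) by (simp add: algebra_simps)
  ultimately have "real L * (d / real M) = of_int c"
    using c by simp
  then have "2 * pi * real (k + L) * (d / real M)
      = 2 * pi * real k * (d / real M) + 2 * pi * of_int c"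
    by (simp only: of_nat_add distrib_left distrib_right mult.assoc)
  moreover have "cis (2 * pi * of_int c) = 1"
    by simp
  ultimately show ?thesis
    by (simp only: cis_conv_exp [symmetric] cis_mult [symmetric] mult_1_right)
qed

theorem lemma1:
  fixes M N S :: nat and X Y x y :: "nat \<Rightarrow> complex"
  assumes "M > 0" and "N \<ge> 1" and "(N + 1) dvd M" and "S \<le> N"
    and "\<forall>n<M. Y n = zero_out N S X n"
    and "\<forall>k<M. x k = idft M X k"
    and "\<forall>k<M. y k = idft M Y k"
  shows "\<exists>r p :: nat \<Rightarrow> complex.
    (\<forall>k<M. y k = x k + r k) \<and>
    (\<forall>k<M. r k = p k * exp (\<i> * of_real (2 * pi * real k * (real S / real M)))) \<and>
    (\<forall>k<M. k + M div (N + 1) < M \<longrightarrow> p k = p (k + M div (N + 1)))"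
proof -
  \<comment> \<open>Below \<open>M\<close>, \<open>W\<close> is \<open>Y - X\<close>: it is
    \<open>- X n\<close> at the removed indices and 0 elsewhere. By linearity its IDFT serves as
    \<open>r\<close>.\<close>
  define W where "W n = zero_out N S X n - X n" for n
  define p where
    "p k = (\<Sum>n<M. W n * exp (\<i> * of_real (2 * pi * real k * ((real n - real S) / real M))))" for k
  \<comment> \<open>Writing the frequency as \<open>n = (n - S) + S\<close> splits off a factor
    independent of \<open>n\<close>.\<close>
  have "idft M W k = p k * exp (\<i> * of_real (2 * pi * real k * (real S / real M)))" for k
    unfolding idft_def p_def sum_distrib_right
    by (intro sum.cong refl)
       (simp add: mult.assoc exp_add [symmetric] algebra_simps diff_divide_distrib)
  moreover have "y k = x k + idft M W k" if "k < M" for k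
    using assms(5-7) that
    by (simp add: idft_def W_def flip: sum.distrib) (simp add: algebra_simps)
  \<comment> \<open>Each summand is already periodic: at removed indices by the lemma with
    \<open>d = n - S\<close>, at the others because \<open>W n = 0\<close>.\<close>
  moreover have "p k = p (k + M div (N + 1))" for k
    unfolding p_def
  proof (intro sum.cong refl)
    fix n
    show "W n * exp (\<i> * of_real (2 * pi * real k * ((real n - real S) / real M)))
      = W n * exp (\<i> * of_real (2 * pi * real (k + M div (N + 1)) * ((real n - real S) / real M)))"
    proof (cases "(real n - real S) / (real N + 1) \<in> \<int>")
      case True
      moreover have "M = (N + 1) * (M div (N + 1))"
        using assms(3) by (simp only: dvd_mult_div_cancel)
      ultimately show ?thesis
        using assms(1) by (simp only: exp_char_periodic)
    next
      case False
      then show ?thesis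
        by (simp add: W_def zero_out_def)
    qed
  qed
  ultimately show ?thesis
    by blast
qed

end
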